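(* Let $D\ge 2$, $\rho\in(0.5,1)$ and $B\ge 1$, and suppose that $1-(2\rho-1)^2B^4<0$. Then for any two data points $(\vec x_i,y_i,a_i)$ and $(\vec x_j,y_j,a_j)$ generated by the biased-sampled data model $p_\rho$ with $y_i=y_j$, $$d(\vec x_i,\rho)\cdot d(\vec x_j,\rho)<0 \iff a_i\neq a_j .$$
   Context: Data model $p_\rho$ (parameters: dimension $D$, bias level $\rho$, scalar constant $B$). A data point is a triple $(\vec x,y,a)$ generated as follows. The label $y$ is uniform on $\{1,-1\}$. Given $y=k$, the spurious attribute $a\in\{1,-1\}$ satisfies $P(a=k\mid y=k)=\rho$ and $P(a=-k\mid y=k)=1-\rho$. The noise $\vec\delta\sim\mathcal N(\vec 0,\vec I^{D-2})$ is a standard Gaussian vector in $\mathbb R^{D-2}$, independent of $(y,a)$. The feature vector is $\vec x=[Ba,\;y,\;\vec\delta]\in\mathbb R^{D}$. A data point generated by $p_\rho$ thus means any triple $(\vec x,y,a)$ with $y,a\in\{1,-1\}$ and $\vec x=[Ba,y,\vec\delta]$ for some $\vec\delta\in\mathbb R^{D-2}$. Centroids. For $k\in\{1,-1\}$, the class centroid is the conditional mean $C_k^{\rho}=\mathbb E[\vec x\mid y=k]$ under $p_\rho$. Relative distance. For a data point $(\vec x_i,y_i)$, $$d(\vec x_i,\rho)=\|\vec x_i-C_{y_i}^{\rho}\|_2^2-\|\vec x_i-C_{q_i}^{\rho}\|_2^2,\qquad q_i=\arg\min_{u\neq y_i}\|\vec x_i-C_u^{\rho}\|_2^2 .$$ Since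 there are only two classes, $q_i=-y_i$. The value $d(\vec x_i,\rho)$ depends on the label $y_i$ of the point as well as on $\vec x_i$. *)

theory Defs
  imports "HOL-Probability.Probability"
begin

text \<open>
  The dimension is quantified inside the statement, so $\mathbb{R}^n$ is rendered as the real-valued
  functions on \<open>{..<n}\<close> (coordinates counted from 0), i.e. the space of the product measure below.
  Labels and spurious attributes are the integers 1 and -1.
\<close>

definition std_gaussian :: "nat \<Rightarrow> (nat \<Rightarrow> real) measure" where
  "std_gaussian n = (\<Pi>\<^sub>M i\<in>{..<n}. std_normal_distribution)"

definition label_attribute_pmf :: "real \<Rightarrow> (int \<times> int) pmf" where
  "label_attribute_pmf \<rho> =
     bind_pmf (pmf_of_set {1, -1}) (\<lambda>y.
       map_pmf (\<lambda>agree. (y, if agree then y else - y)) (bernoulli_pmf \<rho>))"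

definition feature_vector :: "nat \<Rightarrow> real \<Rightarrow> int \<Rightarrow> int \<Rightarrow> (nat \<Rightarrow> real) \<Rightarrow> nat \<Rightarrow> real" where
  "feature_vector D B y a \<delta> =
     (\<lambda>i\<in>{..<D}. if i = 0 then B * of_int a else if i = 1 then of_int y else \<delta> (i - 2))"

definition data_model :: "nat \<Rightarrow> real \<Rightarrow> real \<Rightarrow> ((nat \<Rightarrow> real) \<times> int \<times> int) measure" where
  "data_model D \<rho> B =
     distr (measure_pmf (label_attribute_pmf \<rho>) \<Otimes>\<^sub>M std_gaussian (D - 2))
       ((\<Pi>\<^sub>M i\<in>{..<D}. borel) \<Otimes>\<^sub>M (count_space UNIV \<Otimes>\<^sub>M count_space UNIV))
       (\<lambda>((y, a), \<delta>). (feature_vector D B y a \<delta>, y, a))"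

definition data_points :: "nat \<Rightarrow> real \<Rightarrow> ((nat \<Rightarrow> real) \<times> int \<times> int) set" where
  "data_points D B =
     {(feature_vector D B y a \<delta>, y, a) | y a \<delta>.
        y \<in> {1, -1} \<and> a \<in> {1, -1} \<and> \<delta> \<in> space (std_gaussian (D - 2))}"

text \<open>
  Conditioning on the event that the label is \<open>k\<close>, which has probability 1/2, is
  \<^const>\<open>uniform_measure\<close>; the vector-valued mean is taken coordinatewise.
\<close>

definition centroid :: "nat \<Rightarrow> real \<Rightarrow> real \<Rightarrow> int \<Rightarrow> nat \<Rightarrow> real" where
  "centroid D \<rho> B k =
     (\<lambda>i\<in>{..<D}. \<integral>(x, y, a). x i
        \<partial>uniform_measure (data_model D \<rho> B) {(x, y, a) \<in> space (data_model D \<rho> B). y = k})"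

definition sq_dist :: "nat \<Rightarrow> (nat \<Rightarrow> real) \<Rightarrow> (nat \<Rightarrow> real) \<Rightarrow> real" where
  "sq_dist D u v = (L2_set (\<lambda>i. u i - v i) {..<D})\<^sup>2"

definition nearest_other_class :: "nat \<Rightarrow> real \<Rightarrow> real \<Rightarrow> (nat \<Rightarrow> real) \<Rightarrow> int \<Rightarrow> int" where
  "nearest_other_class D \<rho> B x y =
     arg_min_on (\<lambda>u. sq_dist D x (centroid D \<rho> B u)) {u \<in> {1, -1}. u \<noteq> y}"

definition relative_distance :: "nat \<Rightarrow> real \<Rightarrow> real \<Rightarrow> (nat \<Rightarrow> real) \<Rightarrow> int \<Rightarrow> real" where
  "relative_distance D \<rho> B x y =
     sq_dist D x (centroid D \<rho> B y)
       - sq_dist D x (centroid D \<rho> B (nearest_other_class D \<rho> B x y))"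

end

theory Submission imports Defs begin

text \<open>
  The centroid of class \<open>k\<close> is \<open>((2\<rho> - 1) B k, k, 0, \<dots>, 0)\<close>, so the noise cancels in the relative
  distance, which equals \<open>- 4 (1 + c y a)\<close> with \<open>c = (2\<rho> - 1) B\<^sup>2\<close>. The hypothesis says \<open>c > 1\<close>, so
  its sign is decided by whether \<open>a\<close> agrees with \<open>y\<close>.
\<close>

text \<open>This is independence in the form used below: \<open>M1\<close> will be the law of label
  and attribute, \<open>M2\<close> that of the noise. The inner integral of the norm is
  \<open>\<bar>f x\<bar>\<close> times a constant, so Fubini applies.\<close>

lemma (in pair_sigma_finite)
  fixes f :: "'a \<Rightarrow> real" and g :: "'b \<Rightarrow> real"
  assumes f: "integrable M1 f" and g: "integrable M2 g"
  shows integrable_mult_pair: "integrable (M1 \<Otimes>\<^sub>M M2) (\<lambda>(x, y). f x * g y)"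
    and integral_mult_pair:
      "(\<integral>(x, y). f x * g y \<partial>(M1 \<Otimes>\<^sub>M M2)) = (\<integral>x. f x \<partial>M1) * (\<integral>y. g y \<partial>M2)"
proof -
  note [measurable] = borel_measurable_integrable[OF f] borel_measurable_integrable[OF g]
  show int: "integrable (M1 \<Otimes>\<^sub>M M2) (\<lambda>(x, y). f x * g y)"
  proof (rule Fubini_integrable)
    show "integrable M1 (\<lambda>x. \<integral>y. norm (case (x, y) of (x, y) \<Rightarrow> f x * g y) \<partial>M2)"
      using f by (simp add: abs_mult)
  qed (use g in simp_all)
  show "(\<integral>(x, y). f x * g y \<partial>(M1 \<Otimes>\<^sub>M M2)) = (\<integral>x. f x \<partial>M1) * (\<integral>y. g y \<partial>M2)"
    using integral_fst'[OF int] by simp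
qed

text \<open>Finiteness and \<open>pos\<close> turn the \<open>ennreal\<close> density of
  \<open>uniform_measure\<close> into a real one, so a conditional mean becomes a quotient of
  ordinary integrals.\<close>

lemma (in finite_measure) integral_uniform_measure:
  fixes f :: "'a \<Rightarrow> real"
  assumes [measurable]: "A \<in> sets M" "f \<in> borel_measurable M"
    and pos: "measure M A \<noteq> 0"
  shows "(\<integral>x. f x \<partial>uniform_measure M A) = (\<integral>x. indicator A x * f x \<partial>M) / measure M A"
proof -
  have "uniform_measure M A = density M (\<lambda>x. ennreal (indicator A x / measure M A))"
    unfolding uniform_measure_def using pos divide_ennreal[of 1 "measure M A"]
    by (intro density_cong)
      (auto simp: emeasure_eq_measure zero_less_measure_iff indicator_def)
  then show ?thesis
    by (simp add: integral_density)
qed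

lemma expectation_label_attribute_pmf:
  fixes h :: "int \<times> int \<Rightarrow> real"
  assumes "0 \<le> \<rho>" "\<rho> \<le> 1"
  shows "measure_pmf.expectation (label_attribute_pmf \<rho>) h
    = (\<rho> * h (1, 1) + (1 - \<rho>) * h (1, -1) + \<rho> * h (-1, -1) + (1 - \<rho>) * h (-1, 1)) / 2"
  unfolding label_attribute_pmf_def
  using assms
  by (subst pmf_expectation_bind[where A = "{1, -1}"])
    (auto simp: field_simps)

lemma finite_set_label_attribute_pmf: "finite (set_pmf (label_attribute_pmf \<rho>))"
  unfolding label_attribute_pmf_def by auto

lemma prob_space_std_gaussian: "prob_space (std_gaussian n)"
  unfolding std_gaussian_def
  by (intro prob_space_PiM) (rule real_distribution.axioms(1)[OF real_dist_normal_dist])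

lemma sets_std_gaussian [measurable_cong]:
  "sets (std_gaussian n) = sets (\<Pi>\<^sub>M i\<in>{..<n}. borel)"
  unfolding std_gaussian_def by (intro sets_PiM_cong) auto

text \<open>A coordinate projection pushes the product measure forward to its factor, so both claims
  reduce to the first moment of the one-dimensional normal law, which is finite and, being odd,
  zero.\<close>

lemma
  assumes "i < n"
  shows integrable_std_gaussian_component: "integrable (std_gaussian n) (\<lambda>\<delta>. \<delta> i)"
    and integral_std_gaussian_component: "(\<integral>\<delta>. \<delta> i \<partial>std_gaussian n) = 0"
proof -
  have distr: "distr (std_gaussian n) std_normal_distribution (\<lambda>\<delta>. \<delta> i) = std_normal_distribution"
    unfolding std_gaussian_def using assms
    by (intro distr_PiM_component)
      (auto intro: real_distribution.axioms(1)[OF real_dist_normal_dist])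
  have meas: "(\<lambda>\<delta>. \<delta> i) \<in> std_gaussian n \<rightarrow>\<^sub>M std_normal_distribution"
    unfolding std_gaussian_def using assms by (intro measurable_component_singleton) auto
  have "integrable std_normal_distribution (\<lambda>x. x)"
    using integrable_std_normal_distribution_moment[of 1] by simp
  then show "integrable (std_gaussian n) (\<lambda>\<delta>. \<delta> i)"
    by (intro integrable_distr[OF meas, unfolded distr])
  show "(\<integral>\<delta>. \<delta> i \<partial>std_gaussian n) = 0"
    using integral_distr[OF meas, of "\<lambda>x. x", unfolded distr]
      integral_std_normal_distribution_moment_odd[of 1]
    by simp
qed

lemma measurable_feature_vector [measurable]:
  "feature_vector D B y a \<in> std_gaussian (D - 2) \<rightarrow>\<^sub>M (\<Pi>\<^sub>M i\<in>{..<D}. borel)"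
  unfolding feature_vector_def
proof (rule measurable_restrict)
  fix i assume i: "i \<in> {..<D}"
  \<comment> \<open>In the last case the noise index \<open>i - 2\<close> is in range, and
    measurability of that coordinate is read off its integrability.\<close>
  consider "i = 0" | "i = 1" | "i - 2 < D - 2" "i \<noteq> 0" "i \<noteq> 1"
    using i by fastforce
  then show "(\<lambda>\<delta>. if i = 0 then B * of_int a else if i = 1 then of_int y else \<delta> (i - 2))
      \<in> std_gaussian (D - 2) \<rightarrow>\<^sub>M borel"
    by cases (simp_all add: borel_measurable_integrable integrable_std_gaussian_component)
qed

text \<open>The pair \<open>(y, a)\<close> ranges over a countable discrete space, so it is enough
  that the map is measurable in \<open>\<delta>\<close> for each fixed pair.\<close>

lemma measurable_data_model_map:
  "(\<lambda>((y, a), \<delta>). (feature_vector D B y a \<delta>, y, a))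
    \<in> measure_pmf (label_attribute_pmf \<rho>) \<Otimes>\<^sub>M std_gaussian (D - 2)
      \<rightarrow>\<^sub>M (\<Pi>\<^sub>M i\<in>{..<D}. borel) \<Otimes>\<^sub>M (count_space UNIV \<Otimes>\<^sub>M count_space UNIV)"
proof -
  have sets: "sets (measure_pmf (label_attribute_pmf \<rho>) \<Otimes>\<^sub>M std_gaussian (D - 2))
      = sets (count_space UNIV \<Otimes>\<^sub>M std_gaussian (D - 2))"
    by (intro sets_pair_measure_cong) auto
  have "(\<lambda>((y, a), \<delta>). (feature_vector D B y a \<delta>, y, a))
    \<in> (count_space (UNIV :: (int \<times> int) set) \<Otimes>\<^sub>M std_gaussian (D - 2))
      \<rightarrow>\<^sub>M (\<Pi>\<^sub>M i\<in>{..<D}. borel) \<Otimes>\<^sub>M (count_space UNIV \<Otimes>\<^sub>M count_space UNIV)"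
    by (intro measurable_pair_measure_countable1) auto
  then show ?thesis
    by (simp add: measurable_cong_sets[OF sets refl])
qed

lemma sets_data_model [measurable_cong]:
  "sets (data_model D \<rho> B)
    = sets ((\<Pi>\<^sub>M i\<in>{..<D}. borel) \<Otimes>\<^sub>M (count_space UNIV \<Otimes>\<^sub>M count_space UNIV))"
  unfolding data_model_def by simp

lemma prob_space_data_model: "prob_space (data_model D \<rho> B)"
proof -
  interpret G: prob_space "std_gaussian (D - 2)" by (rule prob_space_std_gaussian)
  interpret P: pair_prob_space "measure_pmf (label_attribute_pmf \<rho>)" "std_gaussian (D - 2)" ..
  show ?thesis
    unfolding data_model_def by (intro P.prob_space_distr measurable_data_model_map)
qed

text \<open>Both the class indicator and a single coordinate factor as in \<open>split\<close>.
  Integrability of \<open>u\<close> comes from the finite support of the label-attribute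
  law.\<close>

lemma integral_data_model:
  fixes f :: "(nat \<Rightarrow> real) \<times> int \<times> int \<Rightarrow> real"
  assumes f: "f \<in> borel_measurable (data_model D \<rho> B)"
    and w: "integrable (std_gaussian (D - 2)) w"
    and split: "\<And>y a \<delta>. f (feature_vector D B y a \<delta>, y, a) = u (y, a) * w \<delta>"
  shows "(\<integral>z. f z \<partial>data_model D \<rho> B)
    = measure_pmf.expectation (label_attribute_pmf \<rho>) u * (\<integral>\<delta>. w \<delta> \<partial>std_gaussian (D - 2))"
proof -
  interpret G: prob_space "std_gaussian (D - 2)" by (rule prob_space_std_gaussian)
  interpret P: pair_prob_space "measure_pmf (label_attribute_pmf \<rho>)" "std_gaussian (D - 2)" ..
  have "(\<integral>z. f z \<partial>data_model D \<rho> B)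
      = (\<integral>(l, \<delta>). u l * w \<delta> \<partial>(measure_pmf (label_attribute_pmf \<rho>) \<Otimes>\<^sub>M std_gaussian (D - 2)))"
    unfolding data_model_def
    using f unfolding data_model_def
    by (subst integral_distr[OF measurable_data_model_map])
      (auto simp: split case_prod_beta intro!: Bochner_Integration.integral_cong)
  also have "\<dots> = measure_pmf.expectation (label_attribute_pmf \<rho>) u
      * (\<integral>\<delta>. w \<delta> \<partial>std_gaussian (D - 2))"
    by (intro P.integral_mult_pair w integrable_measure_pmf_finite finite_set_label_attribute_pmf)
  finally show ?thesis .
qed

text \<open>Given label \<open>k\<close>, the attribute has mean
  \<open>\<rho> * k - (1 - \<rho>) * k\<close>, the second coordinate is constantly
  \<open>k\<close>, and the noise is centred.\<close>

lemma centroid_eq: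
  assumes \<rho>: "0 \<le> \<rho>" "\<rho> \<le> 1" and k: "k \<in> {1, -1}" and i: "i < D"
  shows "centroid D \<rho> B k i
    = (if i = 0 then (2 * \<rho> - 1) * B * of_int k else if i = 1 then of_int k else 0)"
proof -
  define M where "M = data_model D \<rho> B"
  define A where "A = {(x :: nat \<Rightarrow> real, y, a :: int) \<in> space M. y = k}"
  interpret G: prob_space "std_gaussian (D - 2)" by (rule prob_space_std_gaussian)
  interpret prob_space M unfolding M_def by (rule prob_space_data_model)
  have sets_M [measurable_cong]: "sets M
      = sets ((\<Pi>\<^sub>M i\<in>{..<D}. borel) \<Otimes>\<^sub>M (count_space UNIV \<Otimes>\<^sub>M count_space UNIV))"
    unfolding M_def by (rule sets_data_model)
  have A [measurable]: "A \<in> sets M"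
  proof -
    have "A = (\<lambda>z. fst (snd z)) -` {k} \<inter> space M"
      unfolding A_def by auto
    moreover have "(\<lambda>z. fst (snd z)) \<in> M \<rightarrow>\<^sub>M count_space UNIV"
      by measurable
    ultimately show ?thesis
      by (simp add: measurable_sets)
  qed
  have coord [measurable]: "(\<lambda>z. fst z i) \<in> borel_measurable M"
  proof -
    have "i \<in> {..<D}"
      using i by simp
    then show ?thesis
      by measurable
  qed
  \<comment> \<open>Membership in \<open>A\<close> also requires membership in
    \<open>space M\<close>; this holds because \<open>feature_vector\<close> is a restricted
    function, hence extensional on \<open>{..<D}\<close>.\<close>
  have ind: "indicator A (feature_vector D B y a \<delta>, y, a) = (of_bool (y = k) :: real)" for y a \<delta>
    using sets_eq_imp_space_eq[OF sets_M]
    by (auto simp: A_def space_pair_measure space_PiM feature_vector_def)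
  \<comment> \<open>Each coordinate depends on the pair \<open>(y, a)\<close> alone or on the noise
    alone; the other factor is set to 1.\<close>
  define u :: "int \<times> int \<Rightarrow> real" where
    "u = (\<lambda>(y, a). if i = 0 then B * of_int a else if i = 1 then of_int y else 1)"
  define w :: "(nat \<Rightarrow> real) \<Rightarrow> real" where
    "w = (\<lambda>\<delta>. if i < 2 then 1 else \<delta> (i - 2))"
  have w: "integrable (std_gaussian (D - 2)) w"
    using i by (cases "i < 2") (simp_all add: w_def integrable_std_gaussian_component)
  have int_w: "(\<integral>\<delta>. w \<delta> \<partial>std_gaussian (D - 2)) = of_bool (i < 2)"
    using i by (cases "i < 2") (simp_all add: w_def G.prob_space integral_std_gaussian_component)
  have "(\<integral>z. indicat_real A z \<partial>M)
      = measure_pmf.expectation (label_attribute_pmf \<rho>) (\<lambda>(y, a). of_bool (y = k))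
        * (\<integral>\<delta>. 1 \<partial>std_gaussian (D - 2))"
    unfolding M_def by (rule integral_data_model) (auto simp: ind M_def[symmetric])
  then have prob_A: "prob A = 1 / 2"
    using k \<rho> by (auto simp: expectation_label_attribute_pmf G.prob_space)
  have split: "feature_vector D B y a \<delta> i = u (y, a) * w \<delta>" for y a \<delta>
    using i by (simp add: feature_vector_def u_def w_def)
  \<comment> \<open>The factor 1/2 in the value of this unnormalised integral is the probability of
    the label \<open>k\<close>; it cancels on division by \<open>prob A\<close>.\<close>
  have "(\<integral>z. indicator A z * fst z i \<partial>M)
      = measure_pmf.expectation (label_attribute_pmf \<rho>) (\<lambda>(y, a). of_bool (y = k) * u (y, a))
        * (\<integral>\<delta>. w \<delta> \<partial>std_gaussian (D - 2))"
    unfolding M_def by (rule integral_data_model) (simp_all add: ind split w M_def[symmetric])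
  also have "\<dots> = (if i = 0 then (2 * \<rho> - 1) * B * of_int k else if i = 1 then of_int k else 0) / 2"
    unfolding int_w expectation_label_attribute_pmf[OF \<rho>] u_def using k
    by (elim insertE emptyE; cases "i < 2") (simp_all add: algebra_simps)
  finally have "(\<integral>z. indicator A z * fst z i \<partial>M) / prob A
      = (if i = 0 then (2 * \<rho> - 1) * B * of_int k else if i = 1 then of_int k else 0)"
    by (simp add: prob_A)
  moreover have "centroid D \<rho> B k i = (\<integral>z. fst z i \<partial>uniform_measure M A)"
    unfolding centroid_def M_def[symmetric] A_def[symmetric] using i
    by (simp add: case_prod_unfold)
  ultimately show ?thesis
    using integral_uniform_measure[OF A coord] prob_A by simp
qed

lemma nearest_other_class_eq:
  assumes "y \<in> {1, -1}"
  shows "nearest_other_class D \<rho> B x y = - y"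
proof -
  have "{u :: int \<in> {1, -1}. u \<noteq> y} = {- y}"
    using assms by auto
  then show ?thesis
    unfolding nearest_other_class_def
    \<comment> \<open>A minimiser over a finite nonempty set lies in that set, here a
      singleton.\<close>
    using arg_min_if_finite(1)[of "{- y}" "\<lambda>u. sq_dist D x (centroid D \<rho> B u)"] by simp
qed

text \<open>The two centroids are negatives of each other, so in the difference all squares cancel
  and only the cross terms remain: -4 from the label coordinate and
  \<open>- 4 * (2 * \<rho> - 1) * B\<^sup>2 * y * a\<close> from the attribute coordinate.\<close>

lemma relative_distance_eq:
  assumes "D \<ge> 2" and \<rho>: "0 \<le> \<rho>" "\<rho> \<le> 1" and point: "(x, y, a) \<in> data_points D B"
  shows "relative_distance D \<rho> B x y = - 4 * (1 + (2 * \<rho> - 1) * B\<^sup>2 * (of_int y * of_int a))"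
proof -
  from point obtain \<delta> where x: "x = feature_vector D B y a \<delta>" and y: "y \<in> {1, -1}" and "a \<in> {1, -1}"
    unfolding data_points_def by auto
  obtain n where D: "D = Suc (Suc n)"
    using \<open>D \<ge> 2\<close> by (metis Suc_le_D numeral_2_eq_2 Suc_le_mono)
  have my: "- y \<in> {1, -1}"
    using y by auto
  have sq: "sq_dist D x (centroid D \<rho> B k) =
      (B * of_int a - (2 * \<rho> - 1) * B * of_int k)\<^sup>2 + (of_int y - of_int k)\<^sup>2 + (\<Sum>i<n. (\<delta> i)\<^sup>2)"
    if k: "k \<in> {1, -1}" for k
  proof -
    have "sq_dist D x (centroid D \<rho> B k) = (\<Sum>i<D. (x i - centroid D \<rho> B k i)\<^sup>2)"
      unfolding sq_dist_def L2_set_def by (simp add: sum_nonneg)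
    also have "\<dots> = (\<Sum>i<D. (x i -
        (if i = 0 then (2 * \<rho> - 1) * B * of_int k else if i = 1 then of_int k else 0))\<^sup>2)"
      by (intro sum.cong refl) (simp only: centroid_eq[OF \<rho> k] lessThan_iff)
    also have "\<dots> = (B * of_int a - (2 * \<rho> - 1) * B * of_int k)\<^sup>2
        + (of_int y - of_int k)\<^sup>2 + (\<Sum>i<n. (\<delta> i)\<^sup>2)"
      \<comment> \<open>Peeling off coordinates 0 and 1 shifts the remaining indices by two, which
        matches the \<open>i - 2\<close> in \<open>feature_vector\<close>.\<close>
      unfolding D sum.lessThan_Suc_shift by (simp add: x D feature_vector_def)
    finally show ?thesis .
  qed
  show ?thesis
    unfolding relative_distance_def nearest_other_class_eq[OF y] sq[OF y] sq[OF my]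
    using y by (auto simp: power2_eq_square algebra_simps)
qed

theorem theorem1:
  fixes D :: nat and \<rho> B :: real
    and x\<^sub>i x\<^sub>j :: "nat \<Rightarrow> real" and y\<^sub>i y\<^sub>j a\<^sub>i a\<^sub>j :: int
  assumes "D \<ge> 2"
    and "1 / 2 < \<rho>" and "\<rho> < 1"
    and "B \<ge> 1"
    and "1 - (2 * \<rho> - 1)\<^sup>2 * B ^ 4 < 0"
    and "(x\<^sub>i, y\<^sub>i, a\<^sub>i) \<in> data_points D B"
    and "(x\<^sub>j, y\<^sub>j, a\<^sub>j) \<in> data_points D B"
    and "y\<^sub>i = y\<^sub>j"
  shows "relative_distance D \<rho> B x\<^sub>i y\<^sub>i * relative_distance D \<rho> B x\<^sub>j y\<^sub>j < 0 \<longleftrightarrow> a\<^sub>i \<noteq> a\<^sub>j"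
proof -
  define c where "c = (2 * \<rho> - 1) * B\<^sup>2"
  have "c\<^sup>2 = (2 * \<rho> - 1)\<^sup>2 * B ^ 4"
    unfolding c_def power_mult_distrib by (simp flip: power_mult)
  \<comment> \<open>The hypothesis only bounds the square of \<open>c\<close>; its root can be taken
    because \<open>\<rho> > 1 / 2\<close> makes \<open>c\<close> nonnegative.\<close>
  then have "1\<^sup>2 < c\<^sup>2"
    using assms(5) by simp
  moreover have "0 \<le> c"
    unfolding c_def using assms(2) by simp
  ultimately have c: "1 < c"
    by (rule power2_less_imp_less)
  have rd: "relative_distance D \<rho> B x y = - 4 * (1 + c * (of_int y * of_int a))"
    if "(x, y, a) \<in> data_points D B" for x y a
    using relative_distance_eq[OF assms(1) _ _ that] assms(2,3) by (simp add: c_def)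
  have "a\<^sub>i \<in> {1, -1}" "a\<^sub>j \<in> {1, -1}" "y\<^sub>j \<in> {1, -1}"
    using assms(6,7) by (auto simp: data_points_def)
  \<comment> \<open>Each factor is \<open>- 4 * (1 + c) < 0\<close> if attribute and label agree and
    \<open>- 4 * (1 - c) > 0\<close> otherwise. As the label is shared, the signs differ exactly
    when the attributes do.\<close>
  then show ?thesis
    using c
    unfolding rd[OF assms(6)[unfolded assms(8)]] rd[OF assms(7)] assms(8)
    by (auto simp: mult_less_0_iff)
qed

end
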